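(* Let $X$ be a sober topological space, and let $f : X \to \Omega(X)$ be the map defined, for each $x \in X$, by $$f(x) = \bigcup\{U \in \Omega(X) \mid \exists V \in \mathcal{N}_x,\ U \cap V = \emptyset\}.$$ The following conditions are equivalent: (1) $X$ is Hausdorff; (2) $X$ is $T_1$ and $f(x)$ is a prime element of the locale $\Omega(X)$ for all $x \in X$.
   Context: For a topological space $X$, $\Omega(X)$ denotes its locale (frame) of open sets, ordered by inclusion and equipped with the Scott topology. For $x \in X$, $\mathcal{N}_x \subseteq \Omega(X)$ denotes the set of all open neighborhoods of $x$ (a Scott open set). Thus $f(x)=\phi(\mathcal{N}_x)$, where for $\mathcal{U}\subseteq \Omega(X)$ Scott open one puts $\phi(\mathcal{U}) = \bigcup\{U \in \Omega(X) \mid \exists V \in \mathcal{U},\ U \cap V = \emptyset\}$. An element $q$ of a locale $L$ is prime if $q \neq 1$ and, for all $a,b \in L$, $a \wedge b \leq q$ implies $a \leq q$ or $b \leq q$. A space is sober if every irreducible closed set is the closure of a unique point; equivalently, if $x \mapsto X \setminus \overline{\{x\}}$ is a bijection from $X$ to the set of prime elements of $\Omega(X)$. *)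

theory Defs
  imports "HOL-Analysis.Analysis" "HOL-Algebra.Complete_Lattice"
begin

no_notation eq_closure_of (\<open>closure'_of\<index>\<close>)

definition Opens :: "'a topology \<Rightarrow> 'a set gorder" (\<open>\<Omega>\<close>) where
  "\<Omega> X = \<lparr>carrier = {U. openin X U}, eq = (=), le = (\<subseteq>)\<rparr>"

definition open_nhds :: "'a topology \<Rightarrow> 'a \<Rightarrow> 'a set set" (\<open>\<N>\<close>) where
  "\<N> X x = {V \<in> carrier (\<Omega> X). x \<in> V}"

definition prime_element :: "('a, 'b) gorder_scheme \<Rightarrow> 'a \<Rightarrow> bool" where
  "prime_element L q \<longleftrightarrow>
     q \<in> carrier L \<and> q \<noteq> \<top>\<^bsub>L\<^esub> \<and>
     (\<forall>a\<in>carrier L. \<forall>b\<in>carrier L.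
        a \<sqinter>\<^bsub>L\<^esub> b \<sqsubseteq>\<^bsub>L\<^esub> q \<longrightarrow> a \<sqsubseteq>\<^bsub>L\<^esub> q \<or> b \<sqsubseteq>\<^bsub>L\<^esub> q)"

text \<open>Irreducible closed sets are nonempty by convention; otherwise no space would be sober,
  since the empty set is not the closure of a point.\<close>

definition irreducible_closedin :: "'a topology \<Rightarrow> 'a set \<Rightarrow> bool" where
  "irreducible_closedin X C \<longleftrightarrow>
     closedin X C \<and> C \<noteq> {} \<and>
     (\<forall>A B. closedin X A \<longrightarrow> closedin X B \<longrightarrow> C = A \<union> B \<longrightarrow> C = A \<or> C = B)"

definition sober_space :: "'a topology \<Rightarrow> bool" where
  "sober_space X \<longleftrightarrow>
     (\<forall>C. irreducible_closedin X C \<longrightarrow> (\<exists>!x. x \<in> topspace X \<and> C = X closure_of {x}))"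

lemma carrier_Opens [simp]: "carrier (\<Omega> X) = {U. openin X U}"
  and le_Opens [simp]: "le (\<Omega> X) = (\<subseteq>)"
  and eq_Opens [simp]: "eq (\<Omega> X) = (=)"
  by (simp_all add: Opens_def)

lemma partial_order_Opens: "partial_order (\<Omega> X)"
  by unfold_locales auto

lemma complete_lattice_Opens: "complete_lattice (\<Omega> X)"
proof (intro complete_lattice.intro complete_lattice_axioms.intro partial_order_Opens)
  fix A assume A: "A \<subseteq> carrier (\<Omega> X)"
  then have "openin X (\<Union>A)"
    by (intro openin_Union) auto
  then have "least (\<Omega> X) (\<Union>A) (Upper (\<Omega> X) A)"
    using A unfolding least_def Upper_def carrier_Opens le_Opens by blast
  then show "\<exists>s. least (\<Omega> X) s (Upper (\<Omega> X) A)" ..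
  let ?I = "\<Union>{U. openin X U \<and> (\<forall>V\<in>A. U \<subseteq> V)}"
  have "openin X ?I"
    by (intro openin_Union) blast
  then have "greatest (\<Omega> X) ?I (Lower (\<Omega> X) A)"
    using A unfolding greatest_def Lower_def carrier_Opens le_Opens by blast
  then show "\<exists>i. greatest (\<Omega> X) i (Lower (\<Omega> X) A)" ..
qed

lemma top_Opens: "\<top>\<^bsub>\<Omega> X\<^esub> = topspace X"
proof -
  have top: "greatest (\<Omega> X) (topspace X) (carrier (\<Omega> X))"
    unfolding greatest_def carrier_Opens le_Opens by (blast dest: openin_subset)
  show ?thesis
    unfolding top_def
    by (rule some_equality, rule top)
       (rule partial_order.greatest_unique [OF partial_order_Opens _ top])
qed

lemma meet_Opens:
  assumes "openin X U" "openin X V"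
  shows "U \<sqinter>\<^bsub>\<Omega> X\<^esub> V = U \<inter> V"
proof -
  have "openin X (U \<inter> V)"
    using assms by (rule openin_Int)
  then have inf: "greatest (\<Omega> X) (U \<inter> V) (Lower (\<Omega> X) {U, V})"
    using assms unfolding greatest_def Lower_def carrier_Opens le_Opens by blast
  show ?thesis
    unfolding meet_def inf_def
    by (rule some_equality, rule inf)
       (rule partial_order.greatest_unique [OF partial_order_Opens _ inf])
qed

end

(* The complement of {x} always contains f x, and it equals f x exactly when x can be separated from
   every other point.  A prime open set is the complement of an irreducible closed set, which in a
   sober T1 space is a singleton; as f x omits x, primality forces f x to be the complement of {x}. *)

theory Submission
  imports Defs
begin

lemma prime_element_Opens_iff:
  "prime_element (\<Omega> X) q \<longleftrightarrow> openin X q \<and> q \<noteq> topspace X \<and>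
     (\<forall>a b. openin X a \<longrightarrow> openin X b \<longrightarrow> a \<inter> b \<subseteq> q \<longrightarrow> a \<subseteq> q \<or> b \<subseteq> q)"
  by (auto simp: prime_element_def top_Opens meet_Opens)

text \<open>Complements turn a decomposition of \<open>topspace X - q\<close> into closed sets
  \<open>A\<close> and \<open>B\<close> into two open sets whose intersection lies in
  \<open>q\<close>; primality puts one of them inside \<open>q\<close>, so the corresponding closed
  set is already everything. Nonemptiness comes from \<open>q\<close> not being the top
  element.\<close>

lemma irreducible_closedin_Compl_prime:
  assumes "prime_element (\<Omega> X) q"
  shows "irreducible_closedin X (topspace X - q)"
  unfolding irreducible_closedin_def
proof (intro conjI allI impI)
  have q: "openin X q" "q \<noteq> topspace X"
    and prime: "\<And>a b. \<lbrakk>openin X a; openin X b; a \<inter> b \<subseteq> q\<rbrakk> \<Longrightarrow> a \<subseteq> q \<or> b \<subseteq> q"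
    using assms unfolding prime_element_Opens_iff by blast+
  show "closedin X (topspace X - q)"
    using q by blast
  show "topspace X - q \<noteq> {}"
    using q openin_subset [OF q(1)] by blast
  fix A B
  assume A: "closedin X A" and B: "closedin X B" and eq: "topspace X - q = A \<union> B"
  then have "topspace X - A \<subseteq> q \<or> topspace X - B \<subseteq> q"
    by (intro prime openin_diff openin_topspace) auto
  then show "topspace X - q = A \<or> topspace X - q = B"
    using eq closedin_subset [OF A] closedin_subset [OF B] by blast
qed

text \<open>An open set lies below \<open>topspace X - {x}\<close> exactly when it omits
  \<open>x\<close>, and if an intersection omits \<open>x\<close>, so does one of the two sets. T1
  makes this complement open.\<close>

lemma prime_element_Compl_singleton:
  assumes "t1_space X" "x \<in> topspace X"
  shows "prime_element (\<Omega> X) (topspace X - {x})"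
  unfolding prime_element_Opens_iff
proof (intro conjI allI impI)
  show "openin X (topspace X - {x})"
    using assms by (intro openin_diff openin_topspace closedin_t1_singleton)
  show "topspace X - {x} \<noteq> topspace X"
    using assms by blast
next
  fix a b
  assume a: "openin X a" and b: "openin X b" and ab: "a \<inter> b \<subseteq> topspace X - {x}"
  show "a \<subseteq> topspace X - {x} \<or> b \<subseteq> topspace X - {x}"
    using openin_subset [OF a] openin_subset [OF b] ab by blast
qed

text \<open>Sobriety supplies a generic point for the complement of \<open>q\<close>, and T1 shrinks
  the closure of that point to the point itself.\<close>

lemma prime_element_sober_t1:
  assumes "sober_space X" "t1_space X" "prime_element (\<Omega> X) q"
  obtains x where "x \<in> topspace X" "q = topspace X - {x}"
proof -
  obtain x where x: "x \<in> topspace X" "topspace X - q = X closure_of {x}"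
    using irreducible_closedin_Compl_prime [OF assms(3)] assms(1)
    unfolding sober_space_def by blast
  moreover have "X closure_of {x} = {x}"
    using assms(2) x(1) by (simp add: closedin_t1_singleton closure_of_closedin)
  moreover have "q \<subseteq> topspace X"
    using assms(3) by (simp add: prime_element_Opens_iff openin_subset)
  ultimately show thesis
    by (intro that [of x]) auto
qed

text \<open>The union collects the points that disjoint open sets separate from \<open>x\<close>, so
  the equation says that these are all the points other than \<open>x\<close>.\<close>

lemma Hausdorff_space_iff_Compl_singleton:
  "Hausdorff_space X \<longleftrightarrow> (\<forall>x\<in>topspace X.
     \<Union>{U \<in> carrier (\<Omega> X). \<exists>V\<in>\<N> X x. U \<inter> V = {}} = topspace X - {x})"
proof -
  have "\<Union>{U \<in> carrier (\<Omega> X). \<exists>V\<in>\<N> X x. U \<inter> V = {}} =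
      {y \<in> topspace X. \<exists>V U. openin X V \<and> openin X U \<and> x \<in> V \<and> y \<in> U \<and> disjnt V U}" for x
    by (auto simp: open_nhds_def disjnt_def Int_commute dest: openin_subset)
  \<comment> \<open>This inclusion holds in every space, since no point is separated from itself;
    being Hausdorff amounts to the reverse inclusion.\<close>
  moreover have "{y \<in> topspace X. \<exists>V U. openin X V \<and> openin X U \<and> x \<in> V \<and> y \<in> U \<and> disjnt V U}
      \<subseteq> topspace X - {x}" for x
    by (auto simp: disjnt_iff)
  ultimately show ?thesis
    unfolding Hausdorff_space_def by (simp add: set_eq_iff) blast
qed

theorem theorem4p3:
  fixes X :: "'a topology" and f :: "'a \<Rightarrow> 'a set"
  assumes sober: "sober_space X"
    and f_def: "\<And>x. x \<in> topspace X \<Longrightarrow>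
      f x = \<Union>{U \<in> carrier (\<Omega> X). \<exists>V \<in> \<N> X x. U \<inter> V = {}}"
  shows "Hausdorff_space X \<longleftrightarrow>
    t1_space X \<and> (\<forall>x \<in> topspace X. prime_element (\<Omega> X) (f x))"
proof -
  have Hausdorff_iff: "Hausdorff_space X \<longleftrightarrow> (\<forall>x\<in>topspace X. f x = topspace X - {x})"
    unfolding Hausdorff_space_iff_Compl_singleton using f_def by simp
  show ?thesis
  proof (intro iffI conjI ballI)
    assume "Hausdorff_space X"
    then show t1: "t1_space X"
      by (rule Hausdorff_imp_t1_space)
    show "prime_element (\<Omega> X) (f x)" if "x \<in> topspace X" for x
      using \<open>Hausdorff_space X\<close> that prime_element_Compl_singleton [OF t1 that]
      unfolding Hausdorff_iff by simp
  next
    assume *: "t1_space X \<and> (\<forall>x\<in>topspace X. prime_element (\<Omega> X) (f x))"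
    show "Hausdorff_space X"
      unfolding Hausdorff_iff
    proof
      fix x
      assume x: "x \<in> topspace X"
      then obtain y where "f x = topspace X - {y}"
        using * prime_element_sober_t1 [OF sober] by metis
      moreover have "x \<notin> f x"
        using f_def [OF x] unfolding open_nhds_def by blast
      \<comment> \<open>If \<open>y\<close> differed from \<open>x\<close>, then \<open>x\<close>
        would lie in \<open>topspace X - {y}\<close>, which is \<open>f x\<close>.\<close>
      ultimately show "f x = topspace X - {x}"
        using x by blast
    qed
  qed
qed

end
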